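(* Let $k>0$ be real. (i) Let $\rho,\alpha,\beta\in\mathbb{C}$ with $\beta\notin\{0,-k,-2k,\dots\}$, and let $x,t\in\mathbb{C}$ satisfy $|x|<\frac1k$, $|t|<\frac1k$ and $\left|\frac{x}{1-kt+k^2xt}\right|<\frac1k$. If the series in $n$ on the left-hand side below converges absolutely, then $$\sum_{n=0}^\infty\frac{(\beta-\rho)_{n,k}}{n!}\,{}_2F_{1,k}\left[\begin{array}{c}\rho-nk,\ \alpha\\ \beta\end{array};x\right]t^n=(1-kt)^{\frac{\alpha+\rho-\beta}{k}}(1-kt+k^2xt)^{-\frac{\alpha}{k}}\,{}_2F_{1,k}\left[\begin{array}{c}\alpha,\ \rho\\ \beta\end{array};\frac{x}{1-kt+k^2xt}\right].$$ (ii) Let $\alpha,\beta,\gamma,\delta\in\mathbb{C}$ with $\beta,\delta\notin\{0,-k,-2k,\dots\}$, and let $x,t\in\mathbb{C}$ satisfy $|t|<\frac1k$ and $|(1-kx)t|<\frac1k$. Then $$\sum_{n=0}^\infty\frac{(\beta)_{n,k}(\gamma)_{n,k}}{(\delta)_{n,k}\,n!}\,{}_2F_{1,k}\left[\begin{array}{c}-nk,\ \alpha\\ \beta\end{array};x\right]t^n=F_{1,k}\left(\gamma,\beta-\alpha,\alpha;\delta;t,(1-kx)t\right).$$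
   Context: For real $k>0$, $a\in\mathbb{C}$ and an integer $n\ge 1$, the Pochhammer $k$-symbol is $(a)_{n,k}=a(a+k)(a+2k)\cdots(a+(n-1)k)$, and $(a)_{0,k}=1$. The $k$-hypergeometric function is $${}_2F_{1,k}\left[\begin{array}{c}\alpha,\ \beta\\ \gamma\end{array};x\right]=\sum_{n=0}^\infty\frac{(\alpha)_{n,k}(\beta)_{n,k}}{(\gamma)_{n,k}}\frac{x^n}{n!},$$ for $|x|<\frac1k$, or for any $x\in\mathbb{C}$ when the series terminates (as it does when an upper parameter equals $-nk$ with $n$ a nonnegative integer). The first Appell $k$-function is $$F_{1,k}(\alpha,\beta,\beta';\gamma;x,y)=\sum_{m,n=0}^\infty\frac{(\alpha)_{m+n,k}(\beta)_{m,k}(\beta')_{n,k}}{(\gamma)_{m+n,k}}\frac{x^m}{m!}\frac{y^n}{n!},\qquad |x|<\tfrac1k,\ |y|<\tfrac1k.$$ Complex powers are principal values. *)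

theory Defs
  imports "HOL-Analysis.Analysis"
begin

definition pochhammer_k :: "real \<Rightarrow> complex \<Rightarrow> nat \<Rightarrow> complex" where
  "pochhammer_k k a n = (\<Prod>i<n. a + of_nat i * of_real k)"

text \<open>The two functions below are given by their defining series and are meaningful only where
  these converge and no denominator vanishes. A terminating series is covered for every \<open>x\<close>,
  since all but finitely many of its terms are zero.\<close>

definition hyp2F1_k :: "real \<Rightarrow> complex \<Rightarrow> complex \<Rightarrow> complex \<Rightarrow> complex \<Rightarrow> complex" where
  "hyp2F1_k k \<alpha> \<beta> \<gamma> x =
     (\<Sum>n. pochhammer_k k \<alpha> n * pochhammer_k k \<beta> n / pochhammer_k k \<gamma> n * (x ^ n / fact n))"

text \<open>The double series is read as an unordered sum over all pairs \<open>(m, n)\<close>; it converges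
  absolutely for \<open>norm x < 1 / k\<close> and \<open>norm y < 1 / k\<close>.\<close>

definition appell_F1_k ::
  "real \<Rightarrow> complex \<Rightarrow> complex \<Rightarrow> complex \<Rightarrow> complex \<Rightarrow> complex \<Rightarrow> complex \<Rightarrow> complex" where
  "appell_F1_k k \<alpha> \<beta> \<beta>' \<gamma> x y =
     (\<Sum>\<^sub>\<infinity>(m, n)\<in>UNIV.
        pochhammer_k k \<alpha> (m + n) * pochhammer_k k \<beta> m * pochhammer_k k \<beta>' n
          / pochhammer_k k \<gamma> (m + n) * (x ^ m / fact m) * (y ^ n / fact n))"

end

theory Submission
  imports Defs "HOL-Complex_Analysis.Conformal_Mappings"
begin

text \<open>
  Since \<open>(a)\<^bsub>n,k\<^esub> = k\<^sup>n (a/k)\<^sub>n\<close>, dividing all parameters by \<open>k\<close> and multiplying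
  all variables by \<open>k\<close> reduces both claims to \<open>k = 1\<close>, that is, to ordinary Pochhammer
  symbols and the Gauss series. Both then rest on one polynomial identity,
  \<open>pochhammer_binomial_identity\<close>, which is the Chu-Vandermonde convolution read
  coefficientwise.

  For the first claim put \<open>d = 1 - t (1 - x)\<close>, so that the right-hand side involves
  \<open>d\<^bsup>-a\<^esup>\<close> and the Gauss series at \<open>x / d\<close>. If \<open>2 |t| < 1 - |x|\<close>, both sides are absolutely
  convergent double series; collected by powers of \<open>x\<close>, their coefficients are elementary
  functions of \<open>t\<close> which the polynomial identity shows to be equal
  (\<open>hyp2F1_transform_near_0\<close>). This settles small \<open>t\<close> only, and principal powers and the
  Gauss series could in principle change branch on the way to a larger \<open>t\<close>. They do not:
  in terms of \<open>d\<close>, the conditions \<open>|t| < \<rho>\<close> (with \<open>\<rho> \<le> 1\<close>) and \<open>|x / d| < 1\<close> say that \<open>d\<close>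
  lies in an open disc centred at \<open>1\<close> with a closed disc around \<open>0\<close> of radius \<open>|x| < 1\<close>
  removed. This region is connected (\<open>connected_ball_diff_cball\<close>) and, as its outer radius is
  at most \<open>|1 - x| \<le> 1 + |x|\<close>, misses the branch cut of the power
  (\<open>lune_avoids_nonpos_reals\<close>). So the right-hand side is single-valued and holomorphic there.
  The left-hand side is a power series in \<open>t\<close>, holomorphic in the disc through the given
  point \<open>t\<^sub>0\<close>, and the identity theorem gives equality in the part of the region with
  \<open>|t| < |t\<^sub>0|\<close>. Absolute convergence at \<open>t\<^sub>0\<close> itself makes the left-hand side continuous along
  the radius up to \<open>t\<^sub>0\<close>, which transfers the equality to \<open>t\<^sub>0\<close> (\<open>hyp2F1_transform\<close>).

  For the second claim, the polynomial identity rewrites \<open>(b)\<^sub>n / n!\<close> times the terminating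
  series with upper parameter \<open>-n\<close> as the convolution of \<open>(b - a)\<^sub>m / m!\<close> and
  \<open>(a)\<^sub>j (1 - x)\<^sup>j / j!\<close>. Hence the terms of the left-hand series are the diagonal sums of the
  absolutely convergent Appell double series
  (\<open>terminating_hyp2F1_generating_function\<close>).
\<close>

section \<open>Double series\<close>

text \<open>Dominated convergence in the form needed below: every majorant that occurs is a binomial
  series in the inner index, so its row sums are known in closed form.\<close>

lemma double_series_summableI:
  fixes f :: "nat \<Rightarrow> nat \<Rightarrow> complex" and B :: "nat \<Rightarrow> nat \<Rightarrow> real"
  assumes bound: "\<And>m n. norm (f m n) \<le> B m n"
    and inner: "\<And>m. B m sums S m" and outer: "summable S"
  shows "(\<lambda>(m, n). f m n) summable_on UNIV"
proof -
  have nonneg: "B m n \<ge> 0" for m n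
    by (rule order_trans[OF norm_ge_zero bound])
  have "S m \<ge> 0" for m
    by (rule sums_le[OF nonneg sums_zero inner])
  then have "S summable_on UNIV"
    using outer by (simp add: summable_on_UNIV_nonneg_real_iff)
  moreover have "(B m has_sum S m) UNIV" for m
    using inner nonneg by (simp add: sums_nonneg_imp_has_sum)
  ultimately have "(\<lambda>(m, n). B m n) summable_on (UNIV \<times> UNIV)"
    by (intro summable_on_SigmaI[where g = S]) (use nonneg in auto)
  then have "(\<lambda>(m, n). B m n) summable_on UNIV"
    by simp
  then have "(\<lambda>p. norm (case p of (m, n) \<Rightarrow> f m n)) summable_on UNIV"
    by (rule summable_on_comparison_test[where f = "\<lambda>(m, n). B m n"]) (use bound in auto)
  then show ?thesis
    by (rule abs_summable_summable)
qed

lemma double_series_by_rows: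
  fixes f :: "nat \<Rightarrow> nat \<Rightarrow> complex"
  assumes "(\<lambda>(m, n). f m n) summable_on UNIV" and row: "\<And>m. f m sums g m"
  shows "g sums (\<Sum>\<^sub>\<infinity>(m, n)\<in>UNIV. f m n)"
proof -
  have sm: "(\<lambda>(m, n). f m n) summable_on (UNIV \<times> UNIV)"
    using assms(1) by simp
  have "(f m has_sum g m) UNIV" for m
  proof -
    have h: "(f m has_sum infsum (f m) UNIV) UNIV"
      using summable_on_SigmaD1[OF sm, of m] by (simp add: has_sum_infsum)
    have "infsum (f m) UNIV = g m"
      by (rule sums_unique2[OF has_sum_imp_sums[OF h] row])
    with h show ?thesis by simp
  qed
  then have "(g has_sum (\<Sum>\<^sub>\<infinity>(m, n)\<in>UNIV \<times> UNIV. f m n)) UNIV"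
    by (intro has_sum_SigmaD[OF has_sum_infsum[OF sm]]) auto
  then show ?thesis
    by (simp add: has_sum_imp_sums)
qed

lemma double_series_by_columns:
  fixes f :: "nat \<Rightarrow> nat \<Rightarrow> complex"
  assumes sm: "(\<lambda>(m, n). f m n) summable_on UNIV" and col: "\<And>n. (\<lambda>m. f m n) sums g n"
  shows "g sums (\<Sum>\<^sub>\<infinity>(m, n)\<in>UNIV. f m n)"
proof -
  have "((\<lambda>(m, n). f m n) has_sum (\<Sum>\<^sub>\<infinity>(m, n)\<in>UNIV. f m n)) (UNIV \<times> UNIV)"
    using sm by simp
  then have "((\<lambda>(n, m). f m n) has_sum (\<Sum>\<^sub>\<infinity>(m, n)\<in>UNIV. f m n)) (UNIV \<times> UNIV)"
    by (subst (asm) has_sum_swap) (simp only: prod.case)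
  then have sw: "((\<lambda>(n, m). f m n) has_sum (\<Sum>\<^sub>\<infinity>(m, n)\<in>UNIV. f m n)) UNIV"
    by simp
  show ?thesis
    using double_series_by_rows[of "\<lambda>n m. f m n" g] col sw
    by (simp add: has_sum_imp_summable infsumI)
qed

lemma double_series_by_diagonals:
  fixes f :: "nat \<Rightarrow> nat \<Rightarrow> complex"
  assumes "(\<lambda>(m, n). f m n) summable_on UNIV"
  shows "(\<lambda>N. \<Sum>j\<le>N. f (N - j) j) sums (\<Sum>\<^sub>\<infinity>(m, n)\<in>UNIV. f m n)"
proof -
  let ?S = "\<Sum>\<^sub>\<infinity>(m, n)\<in>UNIV. f m n"
  have bij: "bij_betw (\<lambda>(N, j). (N - j, j)) (SIGMA N:UNIV. {..N}) (UNIV :: (nat \<times> nat) set)"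
    by (rule bij_betwI[of _ _ _ "\<lambda>(m, j). (m + j, j)"]) auto
  have "((\<lambda>(N, j). f (N - j) j) has_sum ?S) (SIGMA N:UNIV. {..N})"
    using has_sum_reindex_bij_betw[OF bij, of "\<lambda>(m, n). f m n" ?S] has_sum_infsum[OF assms]
    by (simp add: case_prod_unfold)
  then have "((\<lambda>N. \<Sum>j\<le>N. f (N - j) j) has_sum ?S) UNIV"
    by (rule has_sum_SigmaD) (auto intro: has_sum_finite)
  then show ?thesis
    by (rule has_sum_imp_sums)
qed

section \<open>Pochhammer symbols\<close>

lemma binomial_series_complex:
  fixes a z :: complex
  assumes "norm z < 1"
  shows "(\<lambda>n. pochhammer a n / fact n * z ^ n) sums (1 - z) powr (- a)"
proof -
  have "(\<lambda>n. ((- a) gchoose n) * (- z) ^ n) sums (1 + (- z)) powr (- a)"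
    using assms by (intro gen_binomial_complex) simp
  moreover have "((- a) gchoose n) * (- z) ^ n = pochhammer a n / fact n * z ^ n" for n
  proof -
    have "(- 1) ^ n * (- z) ^ n = z ^ n"
      by (simp flip: power_mult_distrib)
    then show ?thesis
      by (simp add: gbinomial_pochhammer)
  qed
  ultimately show ?thesis by simp
qed

lemma binomial_series_real:
  fixes a z :: real
  assumes "\<bar>z\<bar> < 1"
  shows "(\<lambda>n. pochhammer a n / fact n * z ^ n) sums (1 - z) powr (- a)"
proof -
  have "(\<lambda>n. ((- a) gchoose n) * (- z) ^ n) sums (1 + (- z)) powr (- a)"
    using assms by (intro gen_binomial_real) simp
  moreover have "((- a) gchoose n) * (- z) ^ n = pochhammer a n / fact n * z ^ n" for n
  proof -
    have "(- 1) ^ n * (- z) ^ n = z ^ n"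
      by (simp flip: power_mult_distrib)
    then show ?thesis
      by (simp add: gbinomial_pochhammer)
  qed
  ultimately show ?thesis by simp
qed

lemma norm_pochhammer_le:
  fixes a :: complex
  assumes "norm a \<le> s"
  shows "norm (pochhammer a n) \<le> pochhammer s n"
proof (induction n)
  case (Suc n)
  have "norm (a + of_nat n) \<le> s + of_nat n"
    using assms norm_triangle_ineq[of a "of_nat n"] by simp
  moreover have "0 \<le> pochhammer s n"
    by (rule order_trans[OF norm_ge_zero Suc])
  ultimately show ?case
    using Suc by (simp add: pochhammer_Suc norm_mult mult_mono)
qed simp

lemma pochhammer_real_nonneg: "0 \<le> s \<Longrightarrow> 0 \<le> pochhammer (s::real) n"
  by (rule order_trans[OF norm_ge_zero norm_pochhammer_le[of "of_real s"]]) simp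

text \<open>Since \<open>|a + n| / |c + n|\<close> tends to \<open>1\<close>, the terms are even summable by the ratio test. If
  \<open>c\<close> is a nonpositive integer, division by zero makes the terms vanish eventually.\<close>

lemma pochhammer_quotient_bounded:
  fixes a c :: complex and q :: real
  assumes "0 \<le> q" "q < 1"
  obtains C where "0 \<le> C" "\<And>n. norm (pochhammer a n / pochhammer c n) * q ^ n \<le> C"
proof -
  let ?f = "\<lambda>n. norm (pochhammer a n / pochhammer c n) * q ^ n"
  define p where "p = (q + 1) / 2"
  have p: "0 < p" "q < p" "p < 1" using assms by (auto simp: p_def)
  have "summable ?f"
  proof (rule summable_ratio_test)
    fix n :: nat
    assume n: "nat \<lceil>(q * norm a + p * norm c) / (p - q) + norm c + 1\<rceil> \<le> n"
    then have "(q * norm a + p * norm c) / (p - q) + norm c + 1 \<le> n"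
      by linarith
    moreover have "0 \<le> (q * norm a + p * norm c) / (p - q)"
      using p assms by simp
    ultimately have n1: "(q * norm a + p * norm c) / (p - q) \<le> n" and n2: "norm c < n"
      using norm_ge_zero[of c] by linarith+
    have "q * (norm a + n) \<le> p * (n - norm c)"
      using n1 p by (simp add: field_simps)
    moreover have "norm (a + of_nat n) \<le> norm a + n"
      using norm_triangle_ineq[of a "of_nat n"] by simp
    moreover have "real n - norm c \<le> norm (c + of_nat n)"
      using norm_diff_ineq[of "of_nat n" c] by (simp add: add.commute)
    ultimately have "q * norm (a + of_nat n) \<le> p * norm (c + of_nat n)"
      using mult_left_mono[of "norm (a + of_nat n)" "norm a + n" q]
        mult_left_mono[of "n - norm c" "norm (c + of_nat n)" p] assms p by linarith
    moreover have "c + of_nat n \<noteq> 0"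
      using \<open>real n - norm c \<le> norm (c + of_nat n)\<close> n2 by auto
    ultimately have r: "norm ((a + of_nat n) / (c + of_nat n)) * q \<le> p"
      by (simp add: norm_divide field_simps)
    have "?f (Suc n) = (norm ((a + of_nat n) / (c + of_nat n)) * q) * ?f n"
      by (simp add: pochhammer_Suc norm_mult norm_divide mult_ac)
    also have "\<dots> \<le> p * ?f n"
      using r assms by (intro mult_right_mono) auto
    finally show "norm (?f (Suc n)) \<le> p * norm (?f n)"
      using assms by (simp add: abs_mult)
  qed (use p in auto)
  then have "Bseq ?f"
    by (rule summable_imp_Bseq)
  then obtain C where "C > 0" and C: "\<And>n. norm (?f n) \<le> C"
    unfolding Bseq_def by blast
  show ?thesis
  proof (rule that[of C])
    show "?f n \<le> C" for n
      using C[of n] by (rule order_trans[rotated]) (simp del: norm_mult)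
  qed (use \<open>C > 0\<close> in simp)
qed

text \<open>The quotient \<open>(a)\<^sub>n / (c)\<^sub>n\<close> grows only polynomially, so an arbitrarily small enlargement of
  the radius absorbs it. This reduces the convergence of hypergeometric series to that of
  binomial series.\<close>

lemma pochhammer_quotient_growth:
  fixes a c :: complex and r q :: real
  assumes "0 \<le> r" "r < q"
  obtains C where "0 \<le> C" "\<And>n. norm (pochhammer a n / pochhammer c n) * r ^ n \<le> C * q ^ n"
proof -
  have q: "0 < q" using assms by linarith
  obtain C where C: "0 \<le> C" "\<And>n. norm (pochhammer a n / pochhammer c n) * (r / q) ^ n \<le> C"
    by (rule pochhammer_quotient_bounded[of "r / q" a c]) (use assms q in auto)
  show ?thesis
  proof (rule that[OF C(1)])
    fix n
    have "norm (pochhammer a n / pochhammer c n) * r ^ n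
        = norm (pochhammer a n / pochhammer c n) * (r / q) ^ n * q ^ n"
      using q by (simp add: power_divide)
    also have "\<dots> \<le> C * q ^ n"
      using C(2)[of n] q by (intro mult_right_mono) auto
    finally show "norm (pochhammer a n / pochhammer c n) * r ^ n \<le> C * q ^ n" .
  qed
qed

text \<open>Expanding \<open>(u + y)\<^sup>j\<close>, the coefficient of \<open>y\<^sup>i\<close> is a Chu-Vandermonde sum. The homogeneous
  form with both \<open>u\<close> and \<open>y\<close> serves two purposes: \<open>u = -t, y = 1\<close> yields the coefficients
  in the transformation formula, and \<open>u = 1, y = -x\<close> the expansion of a terminating series
  around \<open>x = 1\<close>.\<close>

lemma pochhammer_binomial_identity:
  fixes p q u y :: "'a::comm_ring_1"
  shows "(\<Sum>j\<le>n. of_nat (n choose j) * pochhammer q (n - j) * pochhammer p j * u ^ (n - j) * (u + y) ^ j)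
       = (\<Sum>i\<le>n. of_nat (n choose i) * pochhammer p i * pochhammer (p + q + of_nat i) (n - i)
                   * u ^ (n - i) * y ^ i)" (is "?L = ?R")
proof -
  let ?t = "\<lambda>j i. of_nat (n choose j) * of_nat (j choose i) * pochhammer q (n - j) * pochhammer p j
              * u ^ (n - i) * y ^ i"
  have "?L = (\<Sum>j\<le>n. \<Sum>i\<le>j. ?t j i)"
  proof (rule sum.cong[OF refl])
    fix j assume j: "j \<in> {..n}"
    have "u ^ (n - j) * (u + y) ^ j = (\<Sum>i\<le>j. of_nat (j choose i) * (u ^ (n - i) * y ^ i))"
    proof -
      have "u ^ (n - j) * (u + y) ^ j = (\<Sum>i\<le>j. of_nat (j choose i) * y ^ i * (u ^ (j - i) * u ^ (n - j)))"
        by (subst add.commute, subst binomial_ring) (simp add: sum_distrib_left mult_ac)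
      also have "\<dots> = (\<Sum>i\<le>j. of_nat (j choose i) * (u ^ (n - i) * y ^ i))"
        using j by (intro sum.cong[OF refl]) (simp add: mult_ac flip: power_add)
      finally show ?thesis .
    qed
    then show "of_nat (n choose j) * pochhammer q (n - j) * pochhammer p j * u ^ (n - j) * (u + y) ^ j
                = (\<Sum>i\<le>j. ?t j i)"
      by (simp add: mult.assoc) (simp add: sum_distrib_left mult_ac)
  qed
  also have "\<dots> = (\<Sum>i\<le>n. \<Sum>j\<in>{i..n}. ?t j i)"
    by (subst (1 2) sum.Sigma, simp, simp, simp, simp,
        rule sum.reindex_bij_witness[of _ "\<lambda>(i, j). (j, i)" "\<lambda>(j, i). (i, j)"]) auto
  also have "\<dots> = ?R"
  proof (rule sum.cong[OF refl])
    fix i assume i: "i \<in> {..n}"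
    have "(\<Sum>j\<in>{i..n}. ?t j i) = (\<Sum>l\<le>n - i. ?t (l + i) i)"
      using i by (intro sum.reindex_bij_witness[of _ "\<lambda>l. l + i" "\<lambda>j. j - i"]) auto
    also have "\<dots> = (\<Sum>l\<le>n - i. of_nat (n choose i) * pochhammer p i * u ^ (n - i) * y ^ i
        * (of_nat ((n - i) choose l) * pochhammer (p + of_nat i) l * pochhammer q (n - i - l)))"
    proof (rule sum.cong[OF refl])
      fix l assume l: "l \<in> {..n - i}"
      have "(n choose (l + i)) * ((l + i) choose i) = (n choose i) * ((n - i) choose l)"
        using choose_mult[of i "l + i" n] i l by simp
      then have c: "(of_nat (n choose (l + i)) * of_nat ((l + i) choose i) :: 'a)
                  = of_nat (n choose i) * of_nat ((n - i) choose l)"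
        by (simp flip: of_nat_mult)
      have d: "pochhammer p (l + i) = pochhammer p i * pochhammer (p + of_nat i) l"
        using pochhammer_product'[of p i l] by (simp add: add.commute)
      have e: "n - (l + i) = n - i - l"
        by simp
      show "?t (l + i) i = of_nat (n choose i) * pochhammer p i * u ^ (n - i) * y ^ i
        * (of_nat ((n - i) choose l) * pochhammer (p + of_nat i) l * pochhammer q (n - i - l))"
        unfolding c d e by (simp only: mult_ac)
    qed
    also have "\<dots> = of_nat (n choose i) * pochhammer p i * u ^ (n - i) * y ^ i
                    * pochhammer (p + q + of_nat i) (n - i)"
      using pochhammer_binomial_sum[of "p + of_nat i" q "n - i"]
      by (simp add: sum_distrib_left add_ac)
    finally show "(\<Sum>j\<in>{i..n}. ?t j i)
        = of_nat (n choose i) * pochhammer p i * pochhammer (p + q + of_nat i) (n - i) * u ^ (n - i) * y ^ i"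
      by (simp add: mult_ac)
  qed
  finally show ?thesis .
qed

section \<open>The Gauss hypergeometric series\<close>

definition hyp2F1 :: "complex \<Rightarrow> complex \<Rightarrow> complex \<Rightarrow> complex \<Rightarrow> complex" where
  "hyp2F1 a b c x = (\<Sum>n. pochhammer a n * pochhammer b n / pochhammer c n * (x ^ n / fact n))"

lemma hyp2F1_abs_summable:
  fixes a b c x :: complex
  assumes "norm x < 1"
  shows "summable (\<lambda>n. norm (pochhammer a n * pochhammer b n / pochhammer c n * (x ^ n / fact n)))"
proof -
  define q where "q = (1 + norm x) / 2"
  have q: "norm x < q" "0 < q" "q < 1"
    using assms norm_ge_zero[of x] unfolding q_def by (auto simp: add_pos_nonneg)
  obtain C where C: "0 \<le> C" "\<And>n. norm (pochhammer a n / pochhammer c n) * norm x ^ n \<le> C * q ^ n"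
    by (rule pochhammer_quotient_growth[of "norm x" q a c]) (use q in auto)
  have "summable (\<lambda>n. C * (pochhammer (norm b) n / fact n * q ^ n))"
    using binomial_series_real[of q "norm b"] q by (intro summable_mult) (auto simp: sums_iff)
  then show ?thesis
  proof (rule summable_comparison_test')
    fix n :: nat
    have "norm (norm (pochhammer a n * pochhammer b n / pochhammer c n * (x ^ n / fact n)))
        = (norm (pochhammer a n / pochhammer c n) * norm x ^ n) * (norm (pochhammer b n) / fact n)"
      by (simp add: norm_mult norm_divide norm_power)
    also have "\<dots> \<le> (C * q ^ n) * (pochhammer (norm b) n / fact n)"
      by (intro mult_mono[OF C(2)] divide_right_mono norm_pochhammer_le) (use C q in auto)
    finally show "norm (norm (pochhammer a n * pochhammer b n / pochhammer c n * (x ^ n / fact n)))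
        \<le> C * (pochhammer (norm b) n / fact n * q ^ n)"
      by (simp add: mult_ac)
  qed
qed

lemma hyp2F1_sums:
  assumes "norm x < 1"
  shows "(\<lambda>n. pochhammer a n * pochhammer b n / pochhammer c n * (x ^ n / fact n)) sums hyp2F1 a b c x"
  unfolding hyp2F1_def
  by (rule summable_sums[OF summable_norm_cancel[OF hyp2F1_abs_summable[OF assms]]])

lemma holomorphic_hyp2F1: "hyp2F1 a b c holomorphic_on ball 0 1"
proof (rule power_series_holomorphic)
  fix w :: complex assume "w \<in> ball 0 1"
  then show "(\<lambda>n. pochhammer a n * pochhammer b n / pochhammer c n / fact n * (w - 0) ^ n) sums hyp2F1 a b c w"
    using hyp2F1_sums[of w a b c] by simp
qed

section \<open>The transformation formula near the origin\<close>

text \<open>Up to sign, \<open>(-n)\<^sub>l\<close> is the falling factorial \<open>n (n - 1) \<dots> (n - l + 1)\<close>, so this is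
  \<open>z\<^sup>l\<close> times the \<open>l\<close>-th derivative of the binomial series.\<close>

lemma falling_factorial_binomial_series:
  fixes q z :: complex
  assumes "norm z < 1"
  shows "(\<lambda>n. pochhammer q n / fact n * pochhammer (- of_nat n) l * z ^ n)
           sums (pochhammer q l * (- z) ^ l * ((1 - z) powr (- q) / (1 - z) ^ l))"
proof -
  let ?f = "\<lambda>n. pochhammer q n / fact n * pochhammer (- of_nat n) l * z ^ n"
  have z: "1 - z \<noteq> 0" using assms by auto
  have f0: "?f n = 0" if "n < l" for n
    using that by (simp add: pochhammer_of_nat_eq_0_iff)
  have fl: "?f (m + l) = pochhammer q l * (- z) ^ l * (pochhammer (q + of_nat l) m / fact m * z ^ m)" for m
  proof -
    have "pochhammer (- of_nat (m + l)) l = (- 1) ^ l * pochhammer (1 + of_nat m :: complex) l"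
      by (subst pochhammer_minus) (simp add: add_ac)
    moreover have "(fact (m + l) :: complex) = fact m * pochhammer (1 + of_nat m) l"
      using pochhammer_product'[of "1::complex" m l] by (simp add: pochhammer_fact)
    moreover have "pochhammer q (m + l) = pochhammer q l * pochhammer (q + of_nat l) m"
      using pochhammer_product'[of q l m] by (simp add: add.commute)
    moreover have "pochhammer (1 + of_nat m :: complex) l \<noteq> 0"
      using calculation(2) by (metis fact_nonzero mult_zero_right)
    ultimately show ?thesis
      by (simp add: power_add power_minus[of z] field_simps)
  qed
  have "(1 - z) powr (- (q + of_nat l)) = (1 - z) powr (- q) / (1 - z) ^ l"
    using z powr_diff[of "1 - z" "- q" "of_nat l"] by (simp add: powr_nat)
  then have "(\<lambda>m. ?f (m + l)) sums (pochhammer q l * (- z) ^ l * ((1 - z) powr (- q) / (1 - z) ^ l))"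
    unfolding fl using sums_mult[OF binomial_series_complex[OF assms, of "q + of_nat l"],
        of "pochhammer q l * (- z) ^ l"] by simp
  then show ?thesis
    using sums_zero_iff_shift[of l ?f] f0 by blast
qed

text \<open>The coefficient of \<open>x\<^sup>N\<close> on the left-hand side of the transformation formula, up to a factor
  that does not depend on \<open>z\<close>. Splitting \<open>(r - n)\<^sub>N\<close> by Chu-Vandermonde into products
  \<open>(r)\<^sub>j (-n)\<^bsub>N-j\<^esub>\<close> reduces it to \<open>falling_factorial_binomial_series\<close>, and the polynomial identity brings the
  result into the form in which it arises on the right-hand side.\<close>

lemma shifted_binomial_series:
  fixes q r z :: complex
  assumes "norm z < 1"
  shows "(\<lambda>n. pochhammer q n / fact n * pochhammer (r - of_nat n) N * z ^ n)
           sums ((1 - z) powr (- q) / (1 - z) ^ N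
                 * (\<Sum>i\<le>N. of_nat (N choose i) * pochhammer r i * pochhammer (r + q + of_nat i) (N - i)
                            * (- z) ^ (N - i)))"
proof -
  have z: "1 - z \<noteq> 0" using assms by auto
  let ?P = "(1 - z) powr (- q)"
  let ?c = "\<lambda>j. of_nat (N choose j) * pochhammer r j"
  have "(\<lambda>n. \<Sum>j\<le>N. ?c j * (pochhammer q n / fact n * pochhammer (- of_nat n) (N - j) * z ^ n))
          sums (\<Sum>j\<le>N. ?c j * (pochhammer q (N - j) * (- z) ^ (N - j) * (?P / (1 - z) ^ (N - j))))"
    by (intro sums_sum sums_mult falling_factorial_binomial_series assms)
  moreover have "(\<Sum>j\<le>N. ?c j * (pochhammer q n / fact n * pochhammer (- of_nat n) (N - j) * z ^ n))
        = pochhammer q n / fact n * pochhammer (r - of_nat n) N * z ^ n" for n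
    using pochhammer_binomial_sum[of r "- of_nat n" N]
    by (simp add: sum_distrib_left sum_distrib_right mult_ac)
  moreover have "(\<Sum>j\<le>N. ?c j * (pochhammer q (N - j) * (- z) ^ (N - j) * (?P / (1 - z) ^ (N - j))))
        = ?P / (1 - z) ^ N
          * (\<Sum>j\<le>N. of_nat (N choose j) * pochhammer q (N - j) * pochhammer r j * (- z) ^ (N - j) * (- z + 1) ^ j)"
    unfolding sum_distrib_left
  proof (rule sum.cong[OF refl])
    fix j assume "j \<in> {..N}"
    then have "(1 - z) ^ N = (1 - z) ^ (N - j) * (1 - z) ^ j"
      by (simp flip: power_add)
    then have "?P / (1 - z) ^ (N - j) = ?P / (1 - z) ^ N * (- z + 1) ^ j"
      using z by (simp add: field_simps)
    then show "?c j * (pochhammer q (N - j) * (- z) ^ (N - j) * (?P / (1 - z) ^ (N - j)))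
        = ?P / (1 - z) ^ N * (of_nat (N choose j) * pochhammer q (N - j) * pochhammer r j * (- z) ^ (N - j) * (- z + 1) ^ j)"
      by (simp only: mult_ac)
  qed
  ultimately show ?thesis
    using pochhammer_binomial_identity[of N q r "- z" 1] by simp
qed

text \<open>The arguments of both factors lie strictly between \<open>-\<pi>/2\<close> and \<open>\<pi>/2\<close>, so their sum is
  still a principal argument.\<close>

lemma powr_times_right_half_plane:
  fixes u v s :: complex
  assumes "0 < Re u" "0 < Re v"
  shows "(u * v) powr s = u powr s * v powr s"
proof -
  have nz: "u \<noteq> 0" "v \<noteq> 0" using assms by auto
  then have "\<bar>Im (Ln u)\<bar> < pi / 2" "\<bar>Im (Ln v)\<bar> < pi / 2"
    using assms Re_Ln_pos_lt by blast+
  then have "Ln (u * v) = Ln u + Ln v"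
    using nz by (intro Ln_times_simple) linarith+
  then show ?thesis
    using nz by (simp add: powr_def distrib_left exp_add)
qed

text \<open>Convergence of the left-hand double series for small \<open>t\<close>. As \<open>|(r - n)\<^sub>N| \<le> (|r| + n)\<^sub>N\<close>,
  the \<open>n\<close>-th inner series is at most a constant times \<open>(1 - s)\<^bsup>-n\<^esup>\<close> for any \<open>s\<close> between \<open>|x|\<close> and \<open>1\<close>,
  so the outer series needs \<open>|t| < 1 - s\<close>. The midpoint \<open>s = (1 + |x|) / 2\<close> explains the
  hypothesis.\<close>

lemma hyp2F1_rows_summable:
  fixes a b r x t :: complex
  assumes "2 * norm t < 1 - norm x"
  shows "(\<lambda>(n, N). pochhammer q n / fact n * t ^ n
            * (pochhammer (r - of_nat n) N * pochhammer a N / pochhammer b N * (x ^ N / fact N)))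
         summable_on UNIV"
proof -
  define s where "s = (1 + norm x) / 2"
  have "norm x < 1"
    using assms norm_ge_zero[of t] by linarith
  then have s: "norm x < s" "0 < s" "s < 1" "norm t < 1 - s"
    using assms norm_ge_zero[of x] unfolding s_def by (auto simp: field_simps add_pos_nonneg)
  obtain C where C: "0 \<le> C" "\<And>N. norm (pochhammer a N / pochhammer b N) * norm x ^ N \<le> C * s ^ N"
    by (rule pochhammer_quotient_growth[of "norm x" s a b]) (use s in auto)
  define A where "A n = C * (pochhammer (norm q) n / fact n * norm t ^ n)" for n
  have A0: "0 \<le> A n" for n
    using C by (simp add: A_def pochhammer_real_nonneg)
  show ?thesis
  proof (rule double_series_summableI)
    fix n N :: nat
    have "norm (pochhammer q n / fact n * t ^ n
            * (pochhammer (r - of_nat n) N * pochhammer a N / pochhammer b N * (x ^ N / fact N)))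
        = norm (pochhammer q n) / fact n * norm t ^ n * (norm (pochhammer (r - of_nat n) N) / fact N)
            * (norm (pochhammer a N / pochhammer b N) * norm x ^ N)"
      by (simp add: norm_mult norm_divide norm_power mult_ac)
    also have "\<dots> \<le> pochhammer (norm q) n / fact n * norm t ^ n * (pochhammer (norm r + of_nat n) N / fact N)
            * (C * s ^ N)"
    proof (intro mult_mono[OF _ C(2)] mult_mono divide_right_mono norm_pochhammer_le)
      show "norm (r - of_nat n) \<le> norm r + of_nat n"
        using norm_triangle_ineq4[of r "of_nat n"] by simp
    qed (use s C in \<open>auto simp: pochhammer_real_nonneg\<close>)
    finally show "norm (pochhammer q n / fact n * t ^ n
            * (pochhammer (r - of_nat n) N * pochhammer a N / pochhammer b N * (x ^ N / fact N)))
        \<le> A n * (pochhammer (norm r + of_nat n) N / fact N * s ^ N)"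
      by (simp add: A_def mult_ac)
  next
    show "(\<lambda>N. A n * (pochhammer (norm r + of_nat n) N / fact N * s ^ N))
            sums (A n * (1 - s) powr (- (norm r + of_nat n)))" for n
      using s by (intro sums_mult binomial_series_real) simp
  next
    have "(1 - s) powr (- (norm r + of_nat n)) = (1 - s) powr (- norm r) / (1 - s) ^ n" for n
      using s by (simp add: powr_diff powr_realpow)
    then have "A n * (1 - s) powr (- (norm r + of_nat n))
        = C * (1 - s) powr (- norm r) * (pochhammer (norm q) n / fact n * (norm t / (1 - s)) ^ n)" for n
      by (simp add: A_def power_divide)
    moreover have "summable (\<lambda>n. C * (1 - s) powr (- norm r)
                     * (pochhammer (norm q) n / fact n * (norm t / (1 - s)) ^ n))"
      using binomial_series_real[of "norm t / (1 - s)" "norm q"] s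
      by (intro summable_mult) (auto simp: sums_iff)
    ultimately show "summable (\<lambda>n. A n * (1 - s) powr (- (norm r + of_nat n)))"
      by simp
  qed
qed

text \<open>Convergence of the double series that arises from the right-hand side by writing
  \<open>1 - t + x t = (1 - t) (1 + x t / (1 - t))\<close> and expanding the powers of the second factor.\<close>

lemma expanded_transform_summable:
  fixes a b r x t :: complex
  assumes "2 * norm t < 1 - norm x"
  shows "(\<lambda>(m, j). pochhammer a (m + j) * pochhammer r m / pochhammer b m / (fact m * fact j)
            * x ^ (m + j) * (- t) ^ j / (1 - t) ^ (m + j)) summable_on UNIV"
proof -
  have t: "norm t < 1 / 2" "norm x < 1"
    using assms norm_ge_zero[of x] norm_ge_zero[of t] by linarith+
  have t1: "1 - norm t \<le> norm (1 - t)"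
    using norm_triangle_ineq2[of 1 t] by simp
  then have t2: "0 < norm (1 - t)" using t by linarith
  define Y where "Y = norm x / norm (1 - t)"
  define A where "A = norm a"
  have Y0: "0 \<le> Y" by (simp add: Y_def)
  have "norm x * norm t \<le> norm t"
    using t by (intro mult_left_le_one_le) auto
  then have "norm x * (1 + norm t) < norm (1 - t)"
    using assms t1 by (simp add: algebra_simps)
  then have YT: "Y < 1 - Y * norm t"
    using t2 by (simp add: Y_def field_simps)
  \<comment> \<open>the inner binomial sums contribute \<open>D\<close> to the power \<open>-m\<close>, so the outer series is hypergeometric with argument \<open>Y / D < 1\<close>\<close>
  define D where "D = 1 - Y * norm t"
  have D: "0 < D" "Y < D" using YT Y0 by (auto simp: D_def)
  define E where "E m = pochhammer A m * norm (pochhammer r m / pochhammer b m) / fact m * Y ^ m" for m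
  show ?thesis
  proof (rule double_series_summableI)
    fix m j :: nat
    have p: "pochhammer A (m + j) = pochhammer A m * pochhammer (A + of_nat m) j"
      by (rule pochhammer_product')
    have "norm (pochhammer a (m + j) * pochhammer r m / pochhammer b m / (fact m * fact j)
            * x ^ (m + j) * (- t) ^ j / (1 - t) ^ (m + j))
        = norm (pochhammer a (m + j)) * (norm (pochhammer r m / pochhammer b m) / (fact m * fact j)
            * Y ^ (m + j) * norm t ^ j)"
      by (simp add: Y_def norm_mult norm_divide norm_power power_divide)
    also have "\<dots> \<le> pochhammer A (m + j) * (norm (pochhammer r m / pochhammer b m) / (fact m * fact j)
            * Y ^ (m + j) * norm t ^ j)"
      using Y0 by (intro mult_right_mono norm_pochhammer_le) (auto simp: A_def)
    also have "\<dots> = E m * (pochhammer (A + of_nat m) j / fact j * (Y * norm t) ^ j)"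
      unfolding p E_def by (simp add: power_add power_mult_distrib)
    finally show "norm (pochhammer a (m + j) * pochhammer r m / pochhammer b m / (fact m * fact j)
            * x ^ (m + j) * (- t) ^ j / (1 - t) ^ (m + j))
        \<le> E m * (pochhammer (A + of_nat m) j / fact j * (Y * norm t) ^ j)" .
  next
    have "\<bar>Y * norm t\<bar> < 1"
      using D Y0 by (simp add: D_def)
    then show "(\<lambda>j. E m * (pochhammer (A + of_nat m) j / fact j * (Y * norm t) ^ j))
            sums (E m * D powr (- (A + of_nat m)))" for m
      unfolding D_def by (intro sums_mult binomial_series_real)
  next
    have "D powr (- (A + of_nat m)) = D powr (- A) / D ^ m" for m
      using D by (simp add: powr_diff powr_realpow)
    then have "E m * D powr (- (A + of_nat m))
        = D powr (- A) * norm (pochhammer (of_real A) m * pochhammer r m / pochhammer b m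
                               * (of_real (Y / D) ^ m / fact m))" for m
      using Y0 D pochhammer_real_nonneg[of A m]
      by (simp add: E_def A_def pochhammer_of_real norm_mult norm_divide norm_power power_divide mult_ac)
    moreover have "summable (\<lambda>m. D powr (- A) * norm (pochhammer (of_real A) m * pochhammer r m / pochhammer b m
                               * (of_real (Y / D) ^ m / fact m)))"
      using Y0 D by (intro summable_mult hyp2F1_abs_summable) (simp add: norm_divide)
    ultimately show "summable (\<lambda>m. E m * D powr (- (A + of_nat m)))"
      by simp
  qed
qed

text \<open>Both sides are sums over the powers of \<open>x\<close>: the left-hand double series is summed over \<open>n\<close>
  first, the expanded right-hand one along its diagonals \<open>m + j = N\<close>. Both give the series
  abbreviated \<open>?h\<close> in the proof.\<close>

lemma hyp2F1_transform_near_0: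
  fixes a b r x t :: complex
  assumes b: "\<And>m. b \<noteq> - of_nat m" and small: "2 * norm t < 1 - norm x"
  shows "(\<lambda>n. pochhammer (b - r) n / fact n * hyp2F1 (r - of_nat n) a b x * t ^ n)
          sums ((1 - t) powr (a + r - b) * (1 - t * (1 - x)) powr (- a)
                * hyp2F1 a r b (x / (1 - t * (1 - x))))"
proof -
  have t: "norm t < 1 / 2" "norm x < 1"
    using small norm_ge_zero[of x] norm_ge_zero[of t] by linarith+
  have "1 - norm t \<le> norm (1 - t)"
    using norm_triangle_ineq2[of 1 t] by simp
  then have t2: "norm t < norm (1 - t)" and t0: "1 - t \<noteq> 0" using t by auto
  have bnz: "pochhammer b m \<noteq> 0" for m
    using b by (simp add: pochhammer_eq_0_iff)
  define z where "z = x * t / (1 - t)"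
  have "norm x * norm t \<le> norm t"
    using t by (intro mult_left_le_one_le) auto
  with t2 have "norm x * norm t < norm (1 - t)" by linarith
  then have nz: "norm z < 1"
    using t0 by (simp add: z_def norm_mult norm_divide)
  define w where "w = x / (1 - t * (1 - x))"
  have z0: "1 + z \<noteq> 0"
    using nz by (metis add_eq_0_iff norm_minus_cancel norm_one less_irrefl)
  have fac: "1 - t * (1 - x) = (1 - t) * (1 + z)"
    using t0 by (simp add: z_def field_simps)
  have wz: "w = x / ((1 - t) * (1 + z))"
    by (simp add: w_def fac)
  have "norm x * (1 + norm t) < norm (1 - t)"
    using small \<open>norm x * norm t \<le> norm t\<close> \<open>1 - norm t \<le> norm (1 - t)\<close> by (simp add: algebra_simps)
  moreover have "norm (1 - t) - norm x * norm t \<le> norm (1 - t * (1 - x))"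
    using norm_diff_ineq[of "1 - t" "t * x"] by (simp add: algebra_simps norm_mult)
  ultimately have "norm x < norm (1 - t * (1 - x))"
    by (simp add: algebra_simps)
  then have w1: "norm w < 1"
    by (simp add: w_def norm_divide divide_less_eq)
  let ?f = "\<lambda>n N. pochhammer (b - r) n / fact n * t ^ n
            * (pochhammer (r - of_nat n) N * pochhammer a N / pochhammer b N * (x ^ N / fact N))"
  let ?P = "(1 - t) powr (r - b)"
  let ?g = "\<lambda>m j. ?P * (pochhammer a (m + j) * pochhammer r m / pochhammer b m / (fact m * fact j)
            * x ^ (m + j) * (- t) ^ j / (1 - t) ^ (m + j))"
  let ?h = "\<lambda>N. pochhammer a N / pochhammer b N * (x ^ N / fact N) * (?P / (1 - t) ^ N
              * (\<Sum>i\<le>N. of_nat (N choose i) * pochhammer r i * pochhammer (b + of_nat i) (N - i)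
                         * (- t) ^ (N - i)))"
  let ?S = "\<Sum>\<^sub>\<infinity>(n, N)\<in>UNIV. ?f n N"
  have fsum: "(\<lambda>(n, N). ?f n N) summable_on UNIV"
    by (rule hyp2F1_rows_summable[OF small])
  have lhs: "(\<lambda>n. pochhammer (b - r) n / fact n * t ^ n * hyp2F1 (r - of_nat n) a b x) sums ?S"
    by (rule double_series_by_rows[OF fsum]) (intro sums_mult hyp2F1_sums t)
  have h1: "?h sums ?S"
  proof (rule double_series_by_columns[OF fsum])
    fix N
    have "norm t < 1" using t by simp
    from sums_mult[OF shifted_binomial_series[OF this, of "b - r" r N],
        of "pochhammer a N / pochhammer b N * (x ^ N / fact N)"]
    show "(\<lambda>n. ?f n N) sums ?h N"
      by (simp add: mult_ac)
  qed
  have "(\<lambda>(m, j). ?g m j) summable_on UNIV"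
    using summable_on_cmult_right[OF expanded_transform_summable[OF small, of a r b], of ?P]
    by (simp add: case_prod_unfold)
  \<comment> \<open>the index \<open>j\<close> comes first, so that summing by columns recovers the right-hand side\<close>
  then have gsum: "(\<lambda>(j, m). ?g m j) summable_on UNIV"
    using summable_on_swap[of "\<lambda>(m, j). ?g m j" UNIV UNIV] by simp
  let ?R = "\<Sum>\<^sub>\<infinity>(j, m)\<in>UNIV. ?g m j"
  have "(\<lambda>N. \<Sum>i\<le>N. ?g i (N - i)) sums ?R"
    by (rule double_series_by_diagonals[OF gsum])
  moreover have "(\<Sum>i\<le>N. ?g i (N - i)) = ?h N" for N
    unfolding sum_distrib_left
  proof (rule sum.cong[OF refl])
    fix i assume "i \<in> {..N}"
    then have i: "i \<le> N" by simp
    have "pochhammer b N = pochhammer b i * pochhammer (b + of_nat i) (N - i)"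
      by (rule pochhammer_product[OF i])
    then have "1 / pochhammer b i = pochhammer (b + of_nat i) (N - i) / pochhammer b N"
      using bnz[of i] bnz[of N] by (simp add: field_simps)
    moreover have "1 / (fact i * fact (N - i)) = (of_nat (N choose i) / fact N :: complex)"
      using i by (simp add: binomial_fact)
    moreover have "?g i (N - i) = ?P * pochhammer a N * pochhammer r i * (1 / pochhammer b i)
        * (1 / (fact i * fact (N - i))) * x ^ N * (- t) ^ (N - i) / (1 - t) ^ N"
      using i by simp
    ultimately show "?g i (N - i) = pochhammer a N / pochhammer b N * (x ^ N / fact N) * (?P / (1 - t) ^ N
        * (of_nat (N choose i) * pochhammer r i * pochhammer (b + of_nat i) (N - i) * (- t) ^ (N - i)))"
      by (simp add: mult_ac)
  qed
  ultimately have h2: "?h sums ?R" by simp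
  let ?Q = "(1 - t) powr (a + r - b) * (1 - t * (1 - x)) powr (- a)"
  have powrs: "?P * (1 + z) powr (- a) = ?Q"
  proof -
    have "(1 - t * (1 - x)) powr (- a) = (1 - t) powr (- a) * (1 + z) powr (- a)"
      unfolding fac
    proof (rule powr_times_right_half_plane)
      show "0 < Re (1 - t)"
        using complex_Re_le_cmod[of t] t by simp
      show "0 < Re (1 + z)"
        using abs_Re_le_cmod[of z] nz by simp
    qed
    moreover have "(1 - t) powr (a + r - b) * (1 - t) powr (- a) = ?P"
      by (simp flip: powr_add)
    ultimately show ?thesis by (simp add: mult_ac)
  qed
  have "(\<lambda>m. ?Q * (pochhammer a m * pochhammer r m / pochhammer b m * (w ^ m / fact m))) sums ?R"
  proof (rule double_series_by_columns[OF gsum])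
    fix m
    have "(1 + z) powr (- (a + of_nat m)) = (1 + z) powr (- a) / (1 + z) ^ m"
      using z0 powr_diff[of "1 + z" "- a" "of_nat m"] by (simp add: powr_nat)
    then have "(\<lambda>j. pochhammer (a + of_nat m) j / fact j * (- z) ^ j) sums ((1 + z) powr (- a) / (1 + z) ^ m)"
      using binomial_series_complex[of "- z" "a + of_nat m"] nz by simp
    from sums_mult[OF this, of "?P * pochhammer a m * pochhammer r m / pochhammer b m / fact m * (x / (1 - t)) ^ m"]
    have "(\<lambda>j. ?P * pochhammer a m * pochhammer r m / pochhammer b m / fact m * (x / (1 - t)) ^ m
             * (pochhammer (a + of_nat m) j / fact j * (- z) ^ j))
          sums (?P * pochhammer a m * pochhammer r m / pochhammer b m / fact m * (x / (1 - t)) ^ m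
             * ((1 + z) powr (- a) / (1 + z) ^ m))" .
    moreover have "?P * pochhammer a m * pochhammer r m / pochhammer b m / fact m * (x / (1 - t)) ^ m
             * (pochhammer (a + of_nat m) j / fact j * (- z) ^ j) = ?g m j" for j
    proof -
      have "(- z) ^ j = x ^ j * (- t) ^ j / (1 - t) ^ j"
        by (simp add: z_def flip: power_mult_distrib power_divide)
      then show ?thesis
        by (simp add: pochhammer_product'[of a m j] power_add power_divide mult_ac)
    qed
    moreover have "?P * pochhammer a m * pochhammer r m / pochhammer b m / fact m * (x / (1 - t)) ^ m
             * ((1 + z) powr (- a) / (1 + z) ^ m)
        = ?Q * (pochhammer a m * pochhammer r m / pochhammer b m * (w ^ m / fact m))"
      unfolding wz powrs[symmetric] by (simp add: power_divide power_mult_distrib mult_ac)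
    ultimately show "(\<lambda>j. ?g m j) sums (?Q * (pochhammer a m * pochhammer r m / pochhammer b m * (w ^ m / fact m)))"
      by simp
  qed
  moreover have "(\<lambda>m. ?Q * (pochhammer a m * pochhammer r m / pochhammer b m * (w ^ m / fact m)))
      sums (?Q * hyp2F1 a r b w)"
    by (intro sums_mult hyp2F1_sums w1)
  ultimately have "?R = ?Q * hyp2F1 a r b w"
    by (rule sums_unique2)
  moreover have "?S = ?R"
    using h1 h2 by (rule sums_unique2)
  ultimately show ?thesis
    using lhs by (simp add: w_def mult_ac)
qed

section \<open>Analytic continuation of the transformation formula\<close>

text \<open>Every point \<open>z\<close> of the region can be rotated about \<open>0\<close> to the positive real number \<open>|z|\<close>,
  which does not increase the distance to \<open>1\<close>, and then moved along the real axis to \<open>1\<close>.\<close>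

lemma connected_ball_diff_cball:
  fixes \<rho> R :: real
  assumes "R < 1"
  shows "connected {z :: complex. norm (z - 1) < \<rho> \<and> R < norm z}" (is "connected ?S")
proof -
  have comp: "connected_component ?S 1 z" if z: "z \<in> ?S" for z
  proof -
    define m where "m = norm z"
    have R: "R < m" and \<rho>: "norm (z - 1) < \<rho>" using z by (auto simp: m_def)
    define arc where "arc s = of_real m * cis (s * Arg z)" for s
    define seg where "seg = complex_of_real ` {min 1 m..max 1 m}"
    have z_eq: "z = arc 1"
      using rcis_cmod_Arg[of z] by (simp add: arc_def m_def rcis_def)
    have normsq: "(norm (of_real m * cis \<theta> - 1))\<^sup>2 = m\<^sup>2 + 1 - 2 * m * cos \<theta>" for \<theta>
    proof -
      have "(norm (of_real m * cis \<theta> - 1))\<^sup>2 = (m * cos \<theta> - 1)\<^sup>2 + (m * sin \<theta>)\<^sup>2"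
        by (simp add: cmod_power2)
      also have "\<dots> = m\<^sup>2 * ((sin \<theta>)\<^sup>2 + (cos \<theta>)\<^sup>2) + 1 - 2 * m * cos \<theta>"
        by algebra
      finally show ?thesis by simp
    qed
    have arc: "arc s \<in> ?S" if "s \<in> {0..1}" for s
    proof -
      have "\<bar>Arg z\<bar> \<le> pi"
        using Arg_bounded[of z] by auto
      moreover have "\<bar>s * Arg z\<bar> \<le> \<bar>Arg z\<bar>"
        using that by (simp add: abs_mult mult_left_le_one_le)
      ultimately have "cos \<bar>Arg z\<bar> \<le> cos \<bar>s * Arg z\<bar>"
        by (intro cos_monotone_0_pi_le) auto
      then have "cos (Arg z) \<le> cos (s * Arg z)"
        by simp
      then have "m * cos (Arg z) \<le> m * cos (s * Arg z)"
        by (intro mult_left_mono) (auto simp: m_def)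
      then have "(norm (arc s - 1))\<^sup>2 \<le> (norm (arc 1 - 1))\<^sup>2"
        using normsq[of "s * Arg z"] normsq[of "Arg z"] by (simp add: arc_def)
      then have "norm (arc s - 1) \<le> norm (z - 1)"
        unfolding z_eq[symmetric] by (rule power2_le_imp_le) simp
      moreover have "norm (arc s) = m"
        by (simp add: arc_def m_def norm_mult)
      ultimately show ?thesis
        using R \<rho> by simp
    qed
    have "connected (arc ` {0..1})"
      unfolding arc_def by (intro connected_continuous_image continuous_intros connected_Icc)
    then have "connected_component ?S (arc 0) (arc 1)"
      using arc unfolding connected_component_def by (intro exI[of _ "arc ` {0..1}"]) auto
    moreover have "connected_component ?S 1 (arc 0)"
    proof -
      have "\<bar>m - 1\<bar> \<le> norm (z - 1)"
        using norm_triangle_ineq3[of z 1] by (simp add: m_def)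
      have "of_real y \<in> ?S" if "y \<in> {min 1 m..max 1 m}" for y :: real
      proof -
        have "norm (complex_of_real y - 1) = \<bar>y - 1\<bar>"
          by (metis norm_of_real of_real_1 of_real_diff)
        then show ?thesis
          using that R \<rho> assms \<open>\<bar>m - 1\<bar> \<le> norm (z - 1)\<close> by (auto simp: min_def max_def split: if_splits)
      qed
      then have "seg \<subseteq> ?S"
        by (auto simp only: seg_def)
      moreover have "connected seg"
        unfolding seg_def by (intro connected_continuous_image continuous_intros connected_Icc)
      moreover have "1 \<in> seg" "arc 0 \<in> seg"
        by (auto simp: seg_def arc_def image_iff intro!: bexI[of _ 1] bexI[of _ m])
      ultimately show ?thesis
        unfolding connected_component_def by blast
    qed
    ultimately show ?thesis
      unfolding z_eq by (rule connected_component_trans[rotated])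
  qed
  show ?thesis
    unfolding connected_iff_connected_component
  proof (intro ballI)
    fix y z assume "y \<in> ?S" "z \<in> ?S"
    from connected_component_trans[OF connected_component_sym[OF comp[OF this(1)]] comp[OF this(2)]]
    show "connected_component ?S y z" .
  qed
qed

text \<open>A point \<open>-y\<close> with \<open>y \<ge> 0\<close> has distance \<open>1 + y\<close> from \<open>1\<close>; if \<open>y > |x|\<close>, this exceeds
  \<open>1 + |x| \<ge> |1 - x|\<close>.\<close>

lemma lune_avoids_nonpos_reals:
  fixes x z :: complex
  assumes "norm x < norm z" and "norm (z - 1) < norm (1 - x)"
  shows "z \<notin> \<real>\<^sub>\<le>\<^sub>0"
proof
  assume "z \<in> \<real>\<^sub>\<le>\<^sub>0"
  then obtain y where y: "z = - of_real y" "0 \<le> y"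
    by (metis nonpos_Reals_cases minus_minus neg_0_le_iff_le of_real_minus)
  have "norm (z - 1) = norm (of_real (y + 1) :: complex)"
    unfolding y by (subst norm_minus_cancel[symmetric]) simp
  then have "norm (z - 1) = y + 1"
    using y by (simp only: norm_of_real)
  moreover have "norm (1 - x) \<le> 1 + norm x"
    using norm_triangle_ineq4[of 1 x] by simp
  ultimately show False
    using assms y by simp
qed

text \<open>The terms at \<open>t\<close> itself dominate the series on the whole radius, so it converges uniformly
  there and its sum is continuous up to the endpoint.\<close>

lemma power_series_radial_limit:
  fixes c :: "nat \<Rightarrow> complex" and t :: complex
  assumes "summable (\<lambda>n. norm (c n * t ^ n))"
  shows "((\<lambda>s. \<Sum>n. c n * (of_real s * t) ^ n) \<longlongrightarrow> (\<Sum>n. c n * t ^ n)) (at_left 1)"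
proof -
  have "uniform_limit {0..1} (\<lambda>N s. \<Sum>n<N. c n * (of_real s * t) ^ n)
          (\<lambda>s. \<Sum>n. c n * (of_real s * t) ^ n) sequentially"
  proof (rule Weierstrass_m_test[OF _ assms])
    fix n :: nat and s :: real
    assume "s \<in> {0..1}"
    then have "norm (c n * t ^ n) * s ^ n \<le> norm (c n * t ^ n)"
      by (intro mult_left_le power_le_one) auto
    then show "norm (c n * (of_real s * t) ^ n) \<le> norm (c n * t ^ n)"
      using \<open>s \<in> {0..1}\<close> by (simp add: norm_mult norm_power power_mult_distrib mult_ac)
  qed
  then have "continuous_on {0..1} (\<lambda>s::real. \<Sum>n. c n * (of_real s * t) ^ n)"
    by (rule uniform_limit_theorem[rotated]) (auto intro!: always_eventually continuous_intros)
  from continuous_on_Icc_at_leftD[OF this] show ?thesis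
    by simp
qed

text \<open>The absolute convergence at \<open>t\<close> is used twice: it makes the left-hand side holomorphic for
  \<open>|s| < |t|\<close>, and it yields the radial limit at \<open>t\<close>, which may lie on the boundary of the disc
  of convergence.\<close>

theorem hyp2F1_transform:
  fixes a b r x t :: complex
  assumes b: "\<And>m. b \<noteq> - of_nat m"
    and x: "norm x < 1" and t: "norm t < 1"
    and w: "norm x < norm (1 - t * (1 - x))"
    and abs: "summable (\<lambda>n. norm (pochhammer (b - r) n / fact n * hyp2F1 (r - of_nat n) a b x * t ^ n))"
  shows "(\<lambda>n. pochhammer (b - r) n / fact n * hyp2F1 (r - of_nat n) a b x * t ^ n)
          sums ((1 - t) powr (a + r - b) * (1 - t * (1 - x)) powr (- a)
                * hyp2F1 a r b (x / (1 - t * (1 - x))))"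
proof (cases "t = 0")
  case True
  have "2 * norm t < 1 - norm x" using True x by simp
  from hyp2F1_transform_near_0[OF b this] show ?thesis .
next
  case False
  define c where "c n = pochhammer (b - r) n / fact n * hyp2F1 (r - of_nat n) a b x" for n
  define F where "F s = (\<Sum>n. c n * s ^ n)" for s :: complex
  define G where "G s = (1 - s) powr (a + r - b) * (1 - s * (1 - x)) powr (- a)
                * hyp2F1 a r b (x / (1 - s * (1 - x)))" for s :: complex
  \<comment> \<open>the domain of the right-hand side, and its part inside the disc through \<open>t\<close>\<close>
  define \<Omega> where "\<Omega> = {s :: complex. norm s < 1 \<and> norm x < norm (1 - s * (1 - x))}"
  define S where "S = {s :: complex. norm s < norm t \<and> norm x < norm (1 - s * (1 - x))}"
  have x1: "1 - x \<noteq> 0" using x by auto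
  have t0: "0 < norm t" using False by simp
  have abs': "summable (\<lambda>n. norm (c n * t ^ n))"
    using abs by (simp add: c_def)
  have open_ann: "open {s :: complex. norm s < \<rho> \<and> norm x < norm (1 - s * (1 - x))}" for \<rho>
    by (intro open_Collect_conj open_Collect_less continuous_intros)
  have S\<Omega>: "S \<subseteq> \<Omega>" using t by (auto simp: S_def \<Omega>_def)
  have "G holomorphic_on \<Omega>"
  proof -
    have n1: "1 - s \<notin> \<real>\<^sub>\<le>\<^sub>0" if "s \<in> \<Omega>" for s
      using that complex_Re_le_cmod[of s] by (auto simp: \<Omega>_def complex_nonpos_Reals_iff)
    have n2: "1 - s * (1 - x) \<notin> \<real>\<^sub>\<le>\<^sub>0" if "s \<in> \<Omega>" for s
    proof (rule lune_avoids_nonpos_reals[of x])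
      show "norm (1 - s * (1 - x) - 1) < norm (1 - x)"
        using that x1 by (simp add: \<Omega>_def norm_mult)
    qed (use that in \<open>simp add: \<Omega>_def\<close>)
    have n3: "1 - s * (1 - x) \<noteq> 0" if "s \<in> \<Omega>" for s
      using n2[OF that] by auto
    have "(hyp2F1 a r b \<circ> (\<lambda>s. x / (1 - s * (1 - x)))) holomorphic_on \<Omega>"
    proof (rule holomorphic_on_compose_gen[OF _ holomorphic_hyp2F1])
      show "(\<lambda>s. x / (1 - s * (1 - x))) holomorphic_on \<Omega>"
        by (intro holomorphic_intros n3)
      show "(\<lambda>s. x / (1 - s * (1 - x))) ` \<Omega> \<subseteq> ball 0 1"
      proof
        fix y assume "y \<in> (\<lambda>s. x / (1 - s * (1 - x))) ` \<Omega>"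
        then obtain s where s: "s \<in> \<Omega>" "y = x / (1 - s * (1 - x))" by auto
        then show "y \<in> ball 0 1"
          using n3[OF s(1)] by (simp add: \<Omega>_def norm_divide divide_less_eq)
      qed
    qed
    then show ?thesis
      unfolding G_def o_def by (intro holomorphic_intros n1 n2) auto
  qed
  have F_hol: "F holomorphic_on ball 0 (norm t)"
  proof (rule power_series_holomorphic)
    fix s :: complex assume "s \<in> ball 0 (norm t)"
    then have "summable (\<lambda>n. c n * s ^ n)"
      using powser_inside[OF summable_norm_cancel[OF abs']] by simp
    then show "(\<lambda>n. c n * (s - 0) ^ n) sums F s"
      by (simp add: F_def summable_sums)
  qed
  \<comment> \<open>in the coordinate \<open>z = 1 - s (1 - x)\<close> the region is a disc around \<open>1\<close> minus a disc around \<open>0\<close>\<close>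
  have conn: "connected S"
  proof -
    have "S = (\<lambda>z. (1 - z) / (1 - x)) ` {z. norm (z - 1) < norm t * norm (1 - x) \<and> norm x < norm z}"
      (is "_ = ?f ` ?L")
    proof (intro set_eqI iffI)
      fix s assume "s \<in> S"
      then have "1 - s * (1 - x) \<in> ?L"
        using x1 by (simp add: S_def norm_mult)
      moreover have "s = ?f (1 - s * (1 - x))"
        using x1 by simp
      ultimately show "s \<in> ?f ` ?L" by blast
    next
      fix s assume "s \<in> ?f ` ?L"
      then obtain z where z: "z \<in> ?L" "s = ?f z" by blast
      then have "1 - s * (1 - x) = z"
        using x1 by simp
      then show "s \<in> S"
        using z x1 by (simp add: S_def norm_divide norm_minus_commute divide_less_eq)
    qed
    also have "connected \<dots>"
      using x x1 by (intro connected_continuous_image continuous_intros connected_ball_diff_cball) auto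
    finally show ?thesis .
  qed
  have FG: "F s = G s" if "s \<in> S" for s
  proof (rule analytic_continuation_open[where s = "S \<inter> ball 0 ((1 - norm x) / 2)" and s' = S and f = F and g = G and z = s])
    show "open (S \<inter> ball 0 ((1 - norm x) / 2))" "open S"
      unfolding S_def by (auto intro: open_ann)
    show "S \<inter> ball 0 ((1 - norm x) / 2) \<noteq> {}"
    proof -
      have "0 \<in> S \<inter> ball 0 ((1 - norm x) / 2)"
        using x t0 by (simp add: S_def)
      then show ?thesis by blast
    qed
    show "F holomorphic_on S"
      by (rule holomorphic_on_subset[OF F_hol]) (auto simp: S_def)
    show "G holomorphic_on S"
      by (rule holomorphic_on_subset[OF \<open>G holomorphic_on \<Omega>\<close> S\<Omega>])
    show "F z = G z" if "z \<in> S \<inter> ball 0 ((1 - norm x) / 2)" for z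
    proof -
      have "2 * norm z < 1 - norm x" using that by simp
      from hyp2F1_transform_near_0[OF b this, of r a] show ?thesis
        by (simp add: F_def G_def c_def sums_iff)
    qed
  qed (use conn that in auto)
  have t\<Omega>: "t \<in> \<Omega>" using t w by (simp add: \<Omega>_def)
  have op: "open \<Omega>" unfolding \<Omega>_def by (rule open_ann)
  have "((\<lambda>s::real. of_real s * t) \<longlongrightarrow> of_real 1 * t) (at_left 1)"
    by (intro tendsto_intros)
  then have lim: "((\<lambda>s::real. of_real s * t) \<longlongrightarrow> t) (at_left 1)"
    by simp
  have "isCont G t"
    using holomorphic_on_imp_continuous_on[OF \<open>G holomorphic_on \<Omega>\<close>]
      continuous_on_eq_continuous_at[OF op] t\<Omega> by blast
  then have "((\<lambda>s::real. G (of_real s * t)) \<longlongrightarrow> G t) (at_left 1)"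
    using lim by (rule isCont_tendsto_compose)
  moreover have "\<forall>\<^sub>F s::real in at_left 1. G (of_real s * t) = F (of_real s * t)"
  proof -
    have "\<forall>\<^sub>F s::real in at_left 1. of_real s * t \<in> \<Omega>"
      using lim op t\<Omega> by (rule topological_tendstoD)
    moreover have "\<forall>\<^sub>F s::real in at_left 1. s \<in> {0<..<1}"
      by (rule eventually_at_left_real) simp
    ultimately show ?thesis
    proof eventually_elim
      case (elim s)
      then have "of_real s * t \<in> S"
        using t0 by (simp add: S_def \<Omega>_def norm_mult)
      then show ?case by (simp add: FG)
    qed
  qed
  ultimately have "((\<lambda>s::real. F (of_real s * t)) \<longlongrightarrow> G t) (at_left 1)"
    by (rule Lim_transform_eventually)
  moreover have "((\<lambda>s::real. F (of_real s * t)) \<longlongrightarrow> F t) (at_left 1)"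
    unfolding F_def by (rule power_series_radial_limit[OF abs'])
  ultimately have "F t = G t"
    by (intro tendsto_unique[OF trivial_limit_at_left_real])
  moreover have "(\<lambda>n. c n * t ^ n) sums F t"
    unfolding F_def by (rule summable_sums[OF summable_norm_cancel[OF abs']])
  ultimately show ?thesis
    by (simp add: c_def G_def)
qed

section \<open>Terminating series and the Appell function\<close>

text \<open>The polynomial identity with \<open>u = 1\<close>, \<open>y = -x\<close>: expanding around \<open>x = 1\<close> removes the
  quotient \<open>(a)\<^sub>i / (b)\<^sub>i\<close> and leaves a convolution, which a generating function can exploit.\<close>

lemma terminating_hyp2F1_expansion:
  fixes a b x :: complex
  assumes b: "\<And>m. b \<noteq> - of_nat m"
  shows "pochhammer b n * hyp2F1 (- of_nat n) a b x
       = (\<Sum>j\<le>n. of_nat (n choose j) * pochhammer (b - a) (n - j) * pochhammer a j * (1 - x) ^ j)"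
proof -
  have bnz: "pochhammer b m \<noteq> 0" for m
    using b by (simp add: pochhammer_eq_0_iff)
  have "hyp2F1 (- of_nat n) a b x
      = (\<Sum>i\<le>n. pochhammer (- of_nat n) i * pochhammer a i / pochhammer b i * (x ^ i / fact i))"
    unfolding hyp2F1_def by (rule suminf_finite) (auto simp: pochhammer_of_nat_eq_0_iff)
  then have "pochhammer b n * hyp2F1 (- of_nat n) a b x
      = (\<Sum>i\<le>n. pochhammer b n * (pochhammer (- of_nat n) i * pochhammer a i / pochhammer b i * (x ^ i / fact i)))"
    by (simp add: sum_distrib_left)
  also have "\<dots> = (\<Sum>i\<le>n. of_nat (n choose i) * pochhammer a i * pochhammer (a + (b - a) + of_nat i) (n - i)
                   * 1 ^ (n - i) * (- x) ^ i)"
  proof (rule sum.cong[OF refl])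
    fix i assume "i \<in> {..n}"
    then have "pochhammer b n = pochhammer b i * pochhammer (b + of_nat i) (n - i)"
      by (intro pochhammer_product) simp
    moreover have "(- 1) ^ i * (of_nat (n choose i) :: complex)
        = ((- 1) ^ i * (- 1) ^ i) * (pochhammer (- of_nat n) i / fact i)"
      by (simp only: binomial_gbinomial gbinomial_pochhammer) simp
    then have "(- 1) ^ i * (of_nat (n choose i) :: complex) = pochhammer (- of_nat n) i / fact i"
      by (simp flip: power_mult_distrib)
    then have "pochhammer (- of_nat n) i = (- 1) ^ i * (of_nat (n choose i) :: complex) * fact i"
      by (simp add: field_simps)
    ultimately show "pochhammer b n * (pochhammer (- of_nat n) i * pochhammer a i / pochhammer b i * (x ^ i / fact i))
        = of_nat (n choose i) * pochhammer a i * pochhammer (a + (b - a) + of_nat i) (n - i) * 1 ^ (n - i) * (- x) ^ i"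
      using bnz[of i] by (simp add: power_minus[of x] mult_ac)
  qed
  also have "\<dots> = (\<Sum>j\<le>n. of_nat (n choose j) * pochhammer (b - a) (n - j) * pochhammer a j * 1 ^ (n - j) * (1 + (- x)) ^ j)"
    by (rule pochhammer_binomial_identity[symmetric])
  finally show ?thesis
    by simp
qed

text \<open>After replacing \<open>|y|\<close> and \<open>|z|\<close> by their maximum, the factor depending on \<open>m + n\<close> is absorbed
  by a slightly larger radius \<open>s < 1\<close>, and the double series splits into a product of two
  binomial series.\<close>

lemma appell_F1_summable:
  fixes g p q d y z :: complex
  assumes y: "norm y < 1" and z: "norm z < 1"
  shows "(\<lambda>(m, n). pochhammer g (m + n) * pochhammer p m * pochhammer q n / pochhammer d (m + n)
            * (y ^ m / fact m) * (z ^ n / fact n)) summable_on UNIV"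
proof -
  define r where "r = max (norm y) (norm z)"
  have r: "0 \<le> r" "r < 1" "norm y \<le> r" "norm z \<le> r"
    using y z by (auto simp: r_def le_max_iff_disj)
  define s where "s = (1 + r) / 2"
  have s: "0 < s" "r < s" "s < 1" using r by (auto simp: s_def)
  obtain C where C: "0 \<le> C" "\<And>n. norm (pochhammer g n / pochhammer d n) * r ^ n \<le> C * s ^ n"
    using pochhammer_quotient_growth[OF r(1) s(2)] by blast
  define A where "A m = C * (pochhammer (norm p) m / fact m * s ^ m)" for m
  show ?thesis
  proof (rule double_series_summableI)
    fix m n :: nat
    have "norm (pochhammer g (m + n) * pochhammer p m * pochhammer q n / pochhammer d (m + n)
            * (y ^ m / fact m) * (z ^ n / fact n))
        = norm (pochhammer g (m + n) / pochhammer d (m + n)) * (norm y ^ m * norm z ^ n)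
          * ((norm (pochhammer p m) / fact m) * (norm (pochhammer q n) / fact n))"
      by (simp add: norm_mult norm_divide norm_power mult_ac)
    also have "\<dots> \<le> norm (pochhammer g (m + n) / pochhammer d (m + n)) * (r ^ m * r ^ n)
          * ((norm (pochhammer p m) / fact m) * (norm (pochhammer q n) / fact n))"
      using r by (intro mult_right_mono mult_left_mono mult_mono power_mono) auto
    also have "\<dots> = (norm (pochhammer g (m + n) / pochhammer d (m + n)) * r ^ (m + n))
          * ((norm (pochhammer p m) / fact m) * (norm (pochhammer q n) / fact n))"
      by (simp only: power_add)
    also have "\<dots> \<le> (C * s ^ (m + n))
          * ((pochhammer (norm p) m / fact m) * (pochhammer (norm q) n / fact n))"
      by (intro mult_mono[OF C(2)] mult_mono divide_right_mono norm_pochhammer_le)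
         (use C s in \<open>auto simp: pochhammer_real_nonneg\<close>)
    also have "\<dots> = A m * (pochhammer (norm q) n / fact n * s ^ n)"
      by (simp add: A_def power_add)
    finally show "norm (pochhammer g (m + n) * pochhammer p m * pochhammer q n / pochhammer d (m + n)
            * (y ^ m / fact m) * (z ^ n / fact n)) \<le> A m * (pochhammer (norm q) n / fact n * s ^ n)" .
  next
    show "(\<lambda>n. A m * (pochhammer (norm q) n / fact n * s ^ n)) sums (A m * (1 - s) powr (- norm q))" for m
      using s by (intro sums_mult binomial_series_real) simp
  next
    show "summable (\<lambda>m. A m * (1 - s) powr (- norm q))"
      unfolding A_def using binomial_series_real[of s "norm p"] s
      by (intro summable_mult summable_mult2) (auto simp: sums_iff)
  qed
qed

text \<open>By the expansion around \<open>x = 1\<close>, the \<open>n\<close>-th term on the left is the sum of the Appell series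
  over the diagonal \<open>m + j = n\<close>.\<close>

theorem terminating_hyp2F1_generating_function:
  fixes a b g d x t :: complex
  assumes b: "\<And>m. b \<noteq> - of_nat m" and t: "norm t < 1" and xt: "norm ((1 - x) * t) < 1"
  shows "(\<lambda>n. pochhammer b n * pochhammer g n / (pochhammer d n * fact n) * hyp2F1 (- of_nat n) a b x * t ^ n)
    sums (\<Sum>\<^sub>\<infinity>(m, n)\<in>UNIV. pochhammer g (m + n) * pochhammer (b - a) m * pochhammer a n / pochhammer d (m + n)
            * (t ^ m / fact m) * (((1 - x) * t) ^ n / fact n))"
proof -
  let ?f = "\<lambda>m n. pochhammer g (m + n) * pochhammer (b - a) m * pochhammer a n / pochhammer d (m + n)
            * (t ^ m / fact m) * (((1 - x) * t) ^ n / fact n)"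
  have "(\<Sum>j\<le>n. ?f (n - j) j)
      = pochhammer b n * pochhammer g n / (pochhammer d n * fact n) * hyp2F1 (- of_nat n) a b x * t ^ n" for n
  proof -
    have "(\<Sum>j\<le>n. ?f (n - j) j) = (\<Sum>j\<le>n. pochhammer g n / (pochhammer d n * fact n) * t ^ n
        * (of_nat (n choose j) * pochhammer (b - a) (n - j) * pochhammer a j * (1 - x) ^ j))"
    proof (rule sum.cong[OF refl])
      fix j assume "j \<in> {..n}"
      then have j: "j \<le> n" by simp
      have "t ^ n = t ^ (n - j) * t ^ j"
        using j by (simp flip: power_add)
      moreover have "of_nat (n choose j) / fact n = 1 / (fact j * fact (n - j) :: complex)"
        using j by (simp add: binomial_fact)
      moreover have "pochhammer g n / (pochhammer d n * fact n) * t ^ n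
          * (of_nat (n choose j) * pochhammer (b - a) (n - j) * pochhammer a j * (1 - x) ^ j)
        = pochhammer g n / pochhammer d n * t ^ n
          * ((of_nat (n choose j) / fact n) * pochhammer (b - a) (n - j) * pochhammer a j * (1 - x) ^ j)"
        by simp
      ultimately show "?f (n - j) j = pochhammer g n / (pochhammer d n * fact n) * t ^ n
          * (of_nat (n choose j) * pochhammer (b - a) (n - j) * pochhammer a j * (1 - x) ^ j)"
        using j by (simp add: power_mult_distrib mult_ac)
    qed
    also have "\<dots> = pochhammer g n / (pochhammer d n * fact n) * t ^ n * (pochhammer b n * hyp2F1 (- of_nat n) a b x)"
      unfolding terminating_hyp2F1_expansion[OF b] by (simp only: sum_distrib_left)
    finally show ?thesis
      by (simp add: mult_ac)
  qed
  then show ?thesis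
    using double_series_by_diagonals[OF appell_F1_summable[OF t xt, of g "b - a" a d]] by simp
qed

section \<open>Rescaling to the classical case\<close>

lemma pochhammer_k_eq:
  assumes "k > 0"
  shows "pochhammer_k k a n = of_real k ^ n * pochhammer (a / of_real k) n"
proof (induction n)
  case (Suc n)
  have "pochhammer_k k a (Suc n) = pochhammer_k k a n * (a + of_nat n * of_real k)"
    by (simp add: pochhammer_k_def)
  also have "a + of_nat n * of_real k = of_real k * (a / of_real k + of_nat n)"
    using assms by (simp add: field_simps)
  finally show ?case
    using Suc by (simp add: pochhammer_Suc mult_ac)
qed (simp add: pochhammer_k_def)

lemma hyp2F1_k_eq:
  assumes "k > 0"
  shows "hyp2F1_k k a b c x = hyp2F1 (a / of_real k) (b / of_real k) (c / of_real k) (of_real k * x)"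
  unfolding hyp2F1_k_def hyp2F1_def pochhammer_k_eq[OF assms]
  using assms by (intro suminf_cong) (simp add: power_mult_distrib field_simps)

lemma appell_F1_k_eq:
  assumes "k > 0"
  shows "appell_F1_k k g p q d y z
    = (\<Sum>\<^sub>\<infinity>(m, n)\<in>UNIV. pochhammer (g / of_real k) (m + n) * pochhammer (p / of_real k) m
          * pochhammer (q / of_real k) n / pochhammer (d / of_real k) (m + n)
          * ((of_real k * y) ^ m / fact m) * ((of_real k * z) ^ n / fact n))"
  unfolding appell_F1_k_def pochhammer_k_eq[OF assms]
  using assms by (intro infsum_cong) (auto simp: power_mult_distrib power_add field_simps)

theorem theorem17:
  fixes k :: real
  assumes "k > 0"
  shows
    "(\<forall>\<rho> \<alpha> \<beta> x t :: complex.
        (\<forall>m::nat. \<beta> \<noteq> - (of_nat m * of_real k)) \<longrightarrow>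
        norm x < 1 / k \<longrightarrow>
        norm t < 1 / k \<longrightarrow>
        1 - of_real k * t + (of_real k)\<^sup>2 * x * t \<noteq> 0 \<longrightarrow>
        norm (x / (1 - of_real k * t + (of_real k)\<^sup>2 * x * t)) < 1 / k \<longrightarrow>
        summable (\<lambda>n. norm (pochhammer_k k (\<beta> - \<rho>) n / fact n
                        * hyp2F1_k k (\<rho> - of_nat n * of_real k) \<alpha> \<beta> x * t ^ n)) \<longrightarrow>
        (\<lambda>n. pochhammer_k k (\<beta> - \<rho>) n / fact n
               * hyp2F1_k k (\<rho> - of_nat n * of_real k) \<alpha> \<beta> x * t ^ n)
          sums ((1 - of_real k * t) powr ((\<alpha> + \<rho> - \<beta>) / of_real k)
                * (1 - of_real k * t + (of_real k)\<^sup>2 * x * t) powr (- \<alpha> / of_real k)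
                * hyp2F1_k k \<alpha> \<rho> \<beta> (x / (1 - of_real k * t + (of_real k)\<^sup>2 * x * t))))
     \<and>
     (\<forall>\<alpha> \<beta> \<gamma> \<delta> x t :: complex.
        (\<forall>m::nat. \<beta> \<noteq> - (of_nat m * of_real k)) \<longrightarrow>
        (\<forall>m::nat. \<delta> \<noteq> - (of_nat m * of_real k)) \<longrightarrow>
        norm t < 1 / k \<longrightarrow>
        norm ((1 - of_real k * x) * t) < 1 / k \<longrightarrow>
        (\<lambda>n. pochhammer_k k \<beta> n * pochhammer_k k \<gamma> n / (pochhammer_k k \<delta> n * fact n)
               * hyp2F1_k k (- (of_nat n * of_real k)) \<alpha> \<beta> x * t ^ n)
          sums appell_F1_k k \<gamma> (\<beta> - \<alpha>) \<alpha> \<delta> t ((1 - of_real k * x) * t))"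
proof (intro conjI allI impI)
  let ?k = "complex_of_real k"
  have k0: "?k \<noteq> 0" using assms by simp
  have nk: "norm (?k * u) < 1" if "norm u < 1 / k" for u
    using that assms by (simp add: norm_mult field_simps)
  have bk: "\<beta> / ?k \<noteq> - of_nat m" if "\<forall>m::nat. \<beta> \<noteq> - (of_nat m * ?k)" for \<beta> m
    using that k0 by (auto simp: field_simps)
  {
    fix \<rho> \<alpha> \<beta> x t :: complex
    let ?d = "1 - ?k * t + ?k\<^sup>2 * x * t"
    assume \<beta>: "\<forall>m::nat. \<beta> \<noteq> - (of_nat m * ?k)" and x: "norm x < 1 / k" and t: "norm t < 1 / k"
      and d: "?d \<noteq> 0" and w: "norm (x / ?d) < 1 / k"
      and abs: "summable (\<lambda>n. norm (pochhammer_k k (\<beta> - \<rho>) n / fact n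
                        * hyp2F1_k k (\<rho> - of_nat n * ?k) \<alpha> \<beta> x * t ^ n))"
    have d_eq: "1 - ?k * t * (1 - ?k * x) = ?d"
      by (simp add: algebra_simps power2_eq_square)
    have summand: "pochhammer_k k (\<beta> - \<rho>) n / fact n * hyp2F1_k k (\<rho> - of_nat n * ?k) \<alpha> \<beta> x * t ^ n
      = pochhammer (\<beta> / ?k - \<rho> / ?k) n / fact n
        * hyp2F1 (\<rho> / ?k - of_nat n) (\<alpha> / ?k) (\<beta> / ?k) (?k * x) * (?k * t) ^ n" for n
      using k0 by (simp add: pochhammer_k_eq[OF assms] hyp2F1_k_eq[OF assms] diff_divide_distrib
          power_mult_distrib mult_ac)
    have "norm (?k * x) < norm ?d"
      using nk[OF w] d by (simp add: norm_mult norm_divide divide_less_eq)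
    then have w': "norm (?k * x) < norm (1 - ?k * t * (1 - ?k * x))"
      by (simp only: d_eq)
    have "(\<alpha> + \<rho> - \<beta>) / ?k = \<alpha> / ?k + \<rho> / ?k - \<beta> / ?k"
      by (simp add: add_divide_distrib diff_divide_distrib)
    then show "(\<lambda>n. pochhammer_k k (\<beta> - \<rho>) n / fact n * hyp2F1_k k (\<rho> - of_nat n * ?k) \<alpha> \<beta> x * t ^ n)
          sums ((1 - ?k * t) powr ((\<alpha> + \<rho> - \<beta>) / ?k) * ?d powr (- \<alpha> / ?k) * hyp2F1_k k \<alpha> \<rho> \<beta> (x / ?d))"
      using hyp2F1_transform[OF bk[OF \<beta>] nk[OF x] nk[OF t] w' abs[unfolded summand]]
      unfolding summand unfolding d_eq hyp2F1_k_eq[OF assms] by simp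
  next
    fix \<alpha> \<beta> \<gamma> \<delta> x t :: complex
    assume \<beta>: "\<forall>m::nat. \<beta> \<noteq> - (of_nat m * ?k)" and t: "norm t < 1 / k"
      and xt: "norm ((1 - ?k * x) * t) < 1 / k"
    have summand: "pochhammer_k k \<beta> n * pochhammer_k k \<gamma> n / (pochhammer_k k \<delta> n * fact n)
               * hyp2F1_k k (- (of_nat n * ?k)) \<alpha> \<beta> x * t ^ n
      = pochhammer (\<beta> / ?k) n * pochhammer (\<gamma> / ?k) n / (pochhammer (\<delta> / ?k) n * fact n)
               * hyp2F1 (- of_nat n) (\<alpha> / ?k) (\<beta> / ?k) (?k * x) * (?k * t) ^ n" for n
      using k0 by (simp add: pochhammer_k_eq[OF assms] hyp2F1_k_eq[OF assms] power_mult_distrib mult_ac)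
    have "norm ((1 - ?k * x) * (?k * t)) < 1"
      using nk[OF xt] by (simp add: mult_ac)
    from terminating_hyp2F1_generating_function[OF bk[OF \<beta>] nk[OF t] this, of "\<gamma> / ?k" "\<delta> / ?k" "\<alpha> / ?k"]
    show "(\<lambda>n. pochhammer_k k \<beta> n * pochhammer_k k \<gamma> n / (pochhammer_k k \<delta> n * fact n)
               * hyp2F1_k k (- (of_nat n * ?k)) \<alpha> \<beta> x * t ^ n)
          sums appell_F1_k k \<gamma> (\<beta> - \<alpha>) \<alpha> \<delta> t ((1 - ?k * x) * t)"
      unfolding summand appell_F1_k_eq[OF assms]
      by (simp add: diff_divide_distrib mult.left_commute[of _ ?k])
  }
qed

end
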